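(* Let $p\ge1$, let $h\in\mathbb{R}^p$ with $h_i\ne0$ for all $i\in[p]$, let $f:\mathbb{R}\to\mathbb{R}$ be convex with $f(0)=0$, and let $q\ge2$ be an integer. Let $Q_{\mathrm c}=\{z\in\{0,1\}^p:\mathbf 1^\top z\le q\}$ and $$Z_{Q_{\mathrm c}}=\left\{(z,\beta,t)\in Q_{\mathrm c}\times\mathbb{R}^p\times\mathbb{R}\;:\; f(h^\top\beta)\le t,\ \beta_i(1-z_i)=0\ \ \forall i\in[p]\right\}.$$ Then $$\operatorname{cl\,conv}(Z_{Q_{\mathrm c}})=\Big\{(z,\beta,t)\in[0,1]^p\times\mathbb{R}^{p}\times\mathbb{R}\;:\;\mathbf 1^\top z\le q,\ f(h^\top\beta)\le t,\ (\mathbf 1^\top z)f\Big(\frac{h^\top\beta}{\mathbf 1^\top z}\Big)\le t\Big\}.$$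
   Context: Notation: $[p]=\{1,\dots,p\}$; $\mathbf 1$ is the all-ones vector; $\operatorname{cl\,conv}$ is the closure of the convex hull. Convention for perspectives: for $w>0$ the expression $w f(x/w)$ is the usual one, and for $w=0$ it is understood as $0f(x/0):=\lim_{w\to0^+}w f(x/w)\in(-\infty,+\infty]$ (an inequality with left-hand side $+\infty$ is never satisfied by real $t$). *)

theory Defs
  imports "HOL-Analysis.Analysis"
begin

(* Perspective w f(x/w).  At w = 0 it is the limit for w tending to 0 from the right, which may be
   +infinity, hence the extended real values.  Existence of this limit for the functions of
   interest is perspective_zero below.  Negative w is irrelevant. *)
definition perspective :: "(real \<Rightarrow> real) \<Rightarrow> real \<Rightarrow> real \<Rightarrow> ereal" where
  "perspective f x w =
     (if w = 0 then Lim (at_right 0) (\<lambda>u. ereal (u * f (x / u))) else ereal (w * f (x / w)))"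

definition Q_c :: "nat \<Rightarrow> (real ^ 'p::finite) set" where
  "Q_c q = {z. (\<forall>i. z $ i \<in> {0, 1}) \<and> (\<Sum>i\<in>UNIV. z $ i) \<le> real q}"

definition Z_set ::
  "(real ^ 'p::finite) set \<Rightarrow> (real ^ 'p) \<Rightarrow> (real \<Rightarrow> real) \<Rightarrow> ((real ^ 'p) \<times> (real ^ 'p) \<times> real) set" where
  "Z_set Q h f = {(z, \<beta>, t). z \<in> Q \<and> f (h \<bullet> \<beta>) \<le> t \<and> (\<forall>i. \<beta> $ i * (1 - z $ i) = 0)}"

lemma perspective_antimono:
  fixes f :: "real \<Rightarrow> real"
  assumes "convex_on UNIV f" "f 0 = 0" "0 < u" "u \<le> v"
  shows "v * f (x / v) \<le> u * f (x / u)"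
proof -
  have v: "v > 0" using assms by simp
  have "f ((1 - u/v) *\<^sub>R 0 + (u/v) *\<^sub>R (x/u)) \<le> (1 - u/v) * f 0 + (u/v) * f (x/u)"
    using assms v by (intro convex_onD[OF assms(1)]) auto
  also have "(1 - u/v) *\<^sub>R 0 + (u/v) *\<^sub>R (x/u) = x/v"
    using assms by simp
  finally have "f (x/v) \<le> (u/v) * f (x/u)" using assms by simp
  thus ?thesis using v by (simp add: field_simps)
qed

lemma perspective_zero:
  fixes f :: "real \<Rightarrow> real"
  assumes "convex_on UNIV f" "f 0 = 0"
  shows "((\<lambda>u. ereal (u * f (x / u))) \<longlongrightarrow> perspective f x 0) (at_right 0)"
    and "perspective f x 0 \<noteq> -\<infinity>"
proof -
  let ?g = "\<lambda>u. ereal (u * f (x / u))"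
  let ?S = "SUP u\<in>{0<..}. ?g u"
  have lim: "(?g \<longlongrightarrow> ?S) (at_right 0)"
  proof (rule order_tendstoI)
    fix a assume "a < ?S"
    then obtain v where v: "v > 0" "a < ?g v" by (auto simp: less_SUP_iff)
    have "a < ?g u" if "0 < u" "u < v" for u
      using perspective_antimono[OF assms, of u v x] that v less_le_trans by fastforce
    then show "\<forall>\<^sub>F u in at_right 0. a < ?g u"
      using v(1) unfolding eventually_at_right_field by blast
  next
    fix a assume a: "?S < a"
    have "?g u < a" if "0 < u" for u
      using a that by (meson SUP_upper greaterThan_iff le_less_trans)
    then show "\<forall>\<^sub>F u in at_right 0. ?g u < a"
      unfolding eventually_at_right_field by (intro exI[of _ 1]) auto
  qed
  then have eq: "perspective f x 0 = ?S"
    unfolding perspective_def by (simp add: tendsto_Lim)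
  show "(?g \<longlongrightarrow> perspective f x 0) (at_right 0)"
    using lim eq by simp
  have "?g 1 \<le> ?S" by (rule SUP_upper) simp
  then show "perspective f x 0 \<noteq> -\<infinity>" unfolding eq by auto
qed

end

theory Submission
  imports Defs
begin

text \<open>
  Write \<open>s = \<Sum>\<^sub>i z\<^sub>i\<close> and \<open>x = h \<bullet> \<beta>\<close>.

  Outer inclusion. A finite convex function is the supremum of its affine minorants \<open>r \<mapsto> c r + d\<close>, so
  its perspective at \<open>(x, u)\<close> is the supremum of the linear functions \<open>c x + d u\<close>; this remains true
  at \<open>u = 0\<close>, where the perspective is only defined as a limit, because \<open>f 0 = 0\<close> forces \<open>d \<le> 0\<close>
  (\<open>perspective_le_iff_minorants\<close>). Hence the right-hand side is an intersection of closed
  half-spaces, and it suffices to check that it contains the mixed-binary set.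

  Inner inclusion. Let \<open>C\<close> be any closed convex set containing the mixed-binary set. Since \<open>q \<ge> 2\<close>,
  two indicators may be switched on together, and then \<open>\<beta>\<close> may move arbitrarily far along the kernel
  of \<open>h\<close> within their two coordinates at cost \<open>f 0 = 0\<close>. These rays span the kernel, so \<open>C\<close> is invariant
  under \<open>\<beta> \<mapsto> \<beta> + b\<close> whenever \<open>h \<bullet> b = 0\<close> (\<open>kernel_translation\<close>): only \<open>x\<close> matters, not how it is
  distributed over the coordinates. It remains to treat \<open>z\<close>:
    \<^item> if \<open>s \<ge> 1\<close>, then \<open>z\<close> is a convex combination of nonzero feasible binary vectors
      (\<open>cube_slice_eq_hull_binary\<close>), each of which can carry all of \<open>x\<close> on one of its active coordinates;
    \<^item> if \<open>0 < s < 1\<close>, the point lies on the segment between the origin and its multiple by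
      \<open>1 / s\<close>, to which the first case applies;
    \<^item> if \<open>s = 0\<close>, the point is the limit of points with small positive \<open>s\<close>.
\<close>

section \<open>Perspectives as suprema of affine minorants\<close>

definition affine_minorant :: "(real \<Rightarrow> real) \<Rightarrow> real \<Rightarrow> real \<Rightarrow> bool" where
  "affine_minorant f c d \<longleftrightarrow> (\<forall>r. c * r + d \<le> f r)"

lemma affine_minorantD: "affine_minorant f c d \<Longrightarrow> c * r + d \<le> f r"
  by (simp add: affine_minorant_def)

text \<open>The slope is the right derivative, taken as the infimum of the secant slopes to the right.\<close>

lemma convex_on_supporting_line:
  assumes "convex_on UNIV f"
  obtains c d where "affine_minorant f c d" "f x = c * x + d"
proof -
  define c where "c = Inf ((\<lambda>t. (f x - f t) / (x - t)) ` ({x<..} \<inter> UNIV))"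
  have "f x + c * (y - x) \<le> f y" for y
    unfolding c_def by (rule convex_le_Inf_differential[OF assms]) auto
  then have "affine_minorant f c (f x - c * x)"
    by (simp add: affine_minorant_def algebra_simps)
  then show thesis
    by (rule that) simp
qed

lemma convex_on_le_iff_minorants:
  assumes "convex_on UNIV f"
  shows "f x \<le> t \<longleftrightarrow> (\<forall>c d. affine_minorant f c d \<longrightarrow> c * x + d \<le> t)"
  using convex_on_supporting_line[OF assms, of x] affine_minorantD
  by (metis order_trans)

text \<open>
  Homogenising the epigraph turns the constraint \<open>c x + d \<le> t\<close> of a minorant into \<open>c x + d u \<le> t\<close>.
  At \<open>u = 0\<close> the intercept disappears. The limit of \<open>w f(x/w)\<close> is at least \<open>c x\<close> since it is the
  limit of the lower bounds \<open>c x + d w\<close>. Conversely, a supporting line at \<open>x / w\<close> gives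
  \<open>w f(x/w) = c x + d w \<le> c x\<close>, because \<open>d \<le> f 0 = 0\<close>.
\<close>

lemma perspective_le_iff_minorants:
  assumes "convex_on UNIV f" "f 0 = 0" "u \<ge> 0"
  shows "perspective f x u \<le> ereal t \<longleftrightarrow> (\<forall>c d. affine_minorant f c d \<longrightarrow> c * x + d * u \<le> t)"
proof (cases "u = 0")
  case False
  then have "u > 0" using assms by simp
  then have "perspective f x u \<le> ereal t \<longleftrightarrow> f (x / u) \<le> t / u"
    by (simp add: perspective_def field_simps)
  also have "\<dots> \<longleftrightarrow> (\<forall>c d. affine_minorant f c d \<longrightarrow> c * (x / u) + d \<le> t / u)"
    by (rule convex_on_le_iff_minorants[OF assms(1)])
  also have "\<dots> \<longleftrightarrow> (\<forall>c d. affine_minorant f c d \<longrightarrow> c * x + d * u \<le> t)"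
    using \<open>u > 0\<close> by (simp add: pos_le_divide_eq distrib_right)
  finally show ?thesis .
next
  case True
  note lim = perspective_zero(1)[OF assms(1,2), of x]
  have pos: "\<forall>\<^sub>F w in at_right 0. (0::real) < w"
    by (simp add: eventually_at_right_less)
  have "perspective f x 0 \<le> ereal t" if *: "\<And>c d. affine_minorant f c d \<Longrightarrow> c * x \<le> t"
  proof (rule tendsto_upperbound[OF lim])
    show "\<forall>\<^sub>F w in at_right 0. ereal (w * f (x / w)) \<le> ereal t"
      using pos
    proof eventually_elim
      case (elim w)
      obtain c d where cd: "affine_minorant f c d" "f (x / w) = c * (x / w) + d"
        using convex_on_supporting_line[OF assms(1)] .
      have "d \<le> 0" using affine_minorantD[OF cd(1), of 0] assms(2) by simp
      then have "w * f (x / w) \<le> c * x"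
        using elim cd(2) by (simp add: algebra_simps mult_le_0_iff)
      then show ?case using *[OF cd(1)] by simp
    qed
  qed simp
  moreover have "c * x \<le> t" if cd: "affine_minorant f c d" and le: "perspective f x 0 \<le> ereal t" for c d
  proof -
    have "((\<lambda>w. c * x + d * w) \<longlongrightarrow> c * x + d * 0) (at_right 0)"
      by (intro tendsto_intros)
    then have lim': "((\<lambda>w. ereal (c * x + d * w)) \<longlongrightarrow> ereal (c * x)) (at_right 0)"
      by simp
    have "\<forall>\<^sub>F w in at_right 0. ereal (c * x + d * w) \<le> ereal (w * f (x / w))"
      using pos
    proof eventually_elim
      case (elim w)
      then show ?case
        using mult_left_mono[OF affine_minorantD[OF cd, of "x / w"], of w]
        by (simp add: algebra_simps)
    qed
    then have "ereal (c * x) \<le> perspective f x 0"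
      by (intro tendsto_le[OF _ lim lim']) auto
    then show ?thesis using le by (metis ereal_less_eq(3) order_trans)
  qed
  ultimately show ?thesis using True by auto
qed

section \<open>Slices of the cube between two integers\<close>

lemma extreme_point_no_perturbation:
  assumes "x extreme_point_of S" "x + d \<in> S" "x - d \<in> S"
  shows "d = 0"
proof (rule ccontr)
  assume "d \<noteq> 0"
  moreover have "(x + d) - (x - d) = 2 *\<^sub>R d"
    by (simp add: scaleR_2)
  ultimately have "x - d \<noteq> x + d"
    by (metis diff_self scaleR_eq_0_iff zero_neq_numeral)
  then have "midpoint (x - d) (x + d) \<in> open_segment (x - d) (x + d)"
    by simp
  moreover have "midpoint (x - d) (x + d) = x"
    by (simp add: midpoint_def flip: scaleR_2)
  ultimately show False
    using assms by (auto simp: extreme_point_of_def)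
qed

definition cube_slice :: "int \<Rightarrow> int \<Rightarrow> (real ^ 'n::finite) set" where
  "cube_slice a b =
     {z. (\<forall>i. z $ i \<in> {0..1}) \<and> (\<Sum>i\<in>UNIV. z $ i) \<in> {of_int a..of_int b}}"

lemma sum_axis: "(\<Sum>k\<in>UNIV. axis i (c::real) $ k) = c"
  by (simp add: axis_def)

text \<open>
  A fractional coordinate always allows a symmetric perturbation inside the slice. If there are two of
  them, mass is exchanged between both and the sum is unchanged. If there is only one, the sum is not
  an integer, so both sum constraints have slack and that coordinate may move alone.
\<close>

lemma extreme_point_cube_slice_binary:
  assumes x: "x extreme_point_of cube_slice a b"
  shows "x $ i \<in> {0, 1}"
proof (rule ccontr)
  let ?s = "\<Sum>k\<in>UNIV. x $ k"
  assume "x $ i \<notin> {0, 1}"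
  moreover have xS: "x \<in> cube_slice a b" using x by (simp add: extreme_point_of_def)
  ultimately have i: "0 < x $ i" "x $ i < 1"
    by (auto simp: cube_slice_def order_less_le)
  have cube: "0 \<le> x $ k" "x $ k \<le> 1" for k
    using xS by (auto simp: cube_slice_def)
  have s: "of_int a \<le> ?s" "?s \<le> of_int b" using xS by (auto simp: cube_slice_def)
  show False
  proof (cases "\<exists>j. j \<noteq> i \<and> x $ j \<notin> {0, 1}")
    case True
    then obtain j where j: "j \<noteq> i" "0 < x $ j" "x $ j < 1"
      using cube by (metis insert_iff order_less_le)
    \<comment> \<open>The largest exchange that keeps both coordinates in the unit interval.\<close>
    define \<delta> where "\<delta> = min (min (x $ i) (1 - x $ i)) (min (x $ j) (1 - x $ j))"
    define d where "d = axis i \<delta> - axis j \<delta>"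
    have \<delta>: "0 < \<delta>" "\<delta> \<le> x $ i" "\<delta> \<le> 1 - x $ i" "\<delta> \<le> x $ j" "\<delta> \<le> 1 - x $ j"
      using i j by (auto simp: \<delta>_def)
    have "(\<Sum>k\<in>UNIV. d $ k) = 0"
      by (simp add: d_def sum_subtractf sum_axis)
    moreover have "0 \<le> x $ k + d $ k \<and> x $ k + d $ k \<le> 1 \<and> 0 \<le> x $ k - d $ k \<and> x $ k - d $ k \<le> 1" for k
      using \<delta> cube[of k] j by (simp add: d_def axis_def)
    ultimately have "x + d \<in> cube_slice a b" "x - d \<in> cube_slice a b"
      using s by (simp_all add: cube_slice_def sum.distrib sum_subtractf)
    then have "d = 0" by (rule extreme_point_no_perturbation[OF x])
    then have "d $ i = 0" by simp
    then show False using \<delta> j by (simp add: d_def axis_def)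
  next
    case False
    have "?s \<notin> \<int>"
    proof
      assume "?s \<in> \<int>"
      moreover have "(\<Sum>k\<in>UNIV - {i}. x $ k) \<in> \<int>"
        using False by (intro Ints_sum) force
      moreover have "?s = x $ i + (\<Sum>k\<in>UNIV - {i}. x $ k)"
        by (rule sum.remove) auto
      ultimately have "x $ i \<in> \<int>"
        by (metis Ints_diff add_diff_cancel_right')
      then show False using i by (auto elim!: Ints_cases)
    qed
    then have s': "of_int a < ?s" "?s < of_int b"
      using s by (metis Ints_of_int order_less_le)+
    define \<delta> where "\<delta> = min (min (x $ i) (1 - x $ i)) (min (?s - of_int a) (of_int b - ?s))"
    have \<delta>: "0 < \<delta>" "\<delta> \<le> x $ i" "\<delta> \<le> 1 - x $ i" "\<delta> \<le> ?s - of_int a" "\<delta> \<le> of_int b - ?s"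
      using i s' by (auto simp: \<delta>_def)
    define d where "d = axis i \<delta>"
    have "(\<Sum>k\<in>UNIV. d $ k) = \<delta>"
      by (simp add: d_def sum_axis)
    moreover have "0 \<le> x $ k + d $ k \<and> x $ k + d $ k \<le> 1 \<and> 0 \<le> x $ k - d $ k \<and> x $ k - d $ k \<le> 1" for k
      using \<delta> cube[of k] by (simp add: d_def axis_def)
    ultimately have "x + d \<in> cube_slice a b" "x - d \<in> cube_slice a b"
      using s \<delta> by (simp_all add: cube_slice_def sum.distrib sum_subtractf)
    then have "d = 0" by (rule extreme_point_no_perturbation[OF x])
    then have "d $ i = 0" by simp
    then show False using \<delta> by (simp add: d_def axis_def)
  qed
qed

lemma cube_slice_eq_hull_binary:
  "cube_slice a b = convex hull {z \<in> cube_slice a b. \<forall>i. z $ i \<in> {0, 1}}" (is "?S = convex hull ?B")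
proof
  have eq: "?S = cbox 0 1 \<inter> {z. of_int a \<le> 1 \<bullet> z} \<inter> {z. 1 \<bullet> z \<le> of_int b}"
    by (auto simp: cube_slice_def inner_vec_def mem_box_cart)
  have conv: "convex ?S" unfolding eq
    by (intro convex_Int convex_box convex_halfspace_le convex_halfspace_ge)
  have comp: "compact ?S" unfolding eq
    by (intro compact_Int_closed compact_cbox closed_halfspace_le closed_halfspace_ge)
  have "?S = convex hull {x. x extreme_point_of ?S}"
    by (rule Krein_Milman_Minkowski[OF comp conv])
  also have "\<dots> \<subseteq> convex hull ?B"
    using extreme_point_cube_slice_binary by (intro hull_mono) (auto simp: extreme_point_of_def)
  finally show "?S \<subseteq> convex hull ?B" .
  show "convex hull ?B \<subseteq> ?S"
    by (rule hull_minimal) (use conv in auto)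
qed

section \<open>Recession directions\<close>

text \<open>
  The point \<open>y + d\<close> is the limit of the points at fraction \<open>1 / n\<close> of the way from \<open>y\<close> to
  \<open>a + n d\<close>. Thus one discrete ray anywhere in \<open>C\<close> makes its direction available at every point.
\<close>

lemma closed_convex_recession:
  fixes C :: "'a::real_normed_vector set"
  assumes "closed C" "convex C" "y \<in> C" and ray: "\<And>n::nat. a + real n *\<^sub>R d \<in> C"
  shows "y + d \<in> C"
proof (rule closed_sequentially[OF assms(1)])
  let ?e = "\<lambda>n. 1 / real (Suc n)"
  let ?y = "\<lambda>n. (1 - ?e n) *\<^sub>R y + ?e n *\<^sub>R (a + real (Suc n) *\<^sub>R d)"
  show "?y n \<in> C" for n
    by (rule convexD[OF assms(2,3) ray]) auto
  have e: "?e \<longlonglongrightarrow> 0"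
    using LIMSEQ_inverse_real_of_nat by (simp add: inverse_eq_divide)
  have "?y = (\<lambda>n. (1 - ?e n) *\<^sub>R y + ?e n *\<^sub>R a + d)"
    by (simp add: fun_eq_iff scaleR_add_right add.assoc)
  moreover have "(\<lambda>n. (1 - ?e n) *\<^sub>R y + ?e n *\<^sub>R a + d) \<longlonglongrightarrow> (1 - 0) *\<^sub>R y + 0 *\<^sub>R a + d"
    by (intro tendsto_intros e)
  ultimately show "?y \<longlonglongrightarrow> y + d" by (simp only: diff_zero scaleR_one scaleR_zero_left add_0_right)
qed

lemma translation_sum:
  fixes C :: "'a::comm_monoid_add set"
  assumes "finite I" "\<And>i y. i \<in> I \<Longrightarrow> y \<in> C \<Longrightarrow> y + d i \<in> C" "y \<in> C"
  shows "y + (\<Sum>i\<in>I. d i) \<in> C"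
  using assms by (induction I arbitrary: y) (auto simp flip: add.assoc)

text \<open>
  This is where \<open>q \<ge> 2\<close> enters. With the indicators \<open>i\<close> and \<open>k\<close> on, \<open>\<beta>\<close> may be any multiple of a
  vector supported on \<open>{i, k}\<close> that is orthogonal to \<open>h\<close>. For a fixed pivot \<open>k\<close>, such vectors span the
  kernel of \<open>h\<close>: \<open>b\<close> is the sum of the \<open>v i\<close> below, because the corrections
  that they subtract at the pivot add up to \<open>(h \<bullet> b) / h\<^sub>k = 0\<close>.
\<close>

lemma kernel_translation:
  fixes h :: "real ^ 'p::finite"
  assumes h: "\<And>i. h $ i \<noteq> 0" and f0: "f 0 = 0" and q: "q \<ge> 2"
    and C: "closed C" "convex C" "Z_set (Q_c q) h f \<subseteq> C"
    and b: "h \<bullet> b = 0" and y: "(z, \<beta>, t) \<in> C"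
  shows "(z, \<beta> + b, t) \<in> C"
proof -
  \<comment> \<open>An arbitrary pivot; index types are nonempty.\<close>
  obtain k :: 'p where True by simp
  define v where "v i = axis i (b $ i) - axis k (h $ i * b $ i / h $ k)" for i
  have hb: "(\<Sum>i\<in>UNIV. h $ i * b $ i) = 0"
    using b by (simp add: inner_vec_def)
  have vj: "(\<Sum>i\<in>UNIV. v i $ j) = b $ j" for j
  proof -
    have "(\<Sum>i\<in>UNIV. axis i (b $ i) $ j) = b $ j"
      by (simp add: axis_def eq_commute[of j])
    moreover have "(\<Sum>i\<in>UNIV. axis k (h $ i * b $ i / h $ k) $ j) = 0"
      using hb by (cases "j = k") (simp_all add: axis_def flip: sum_divide_distrib)
    ultimately show ?thesis by (simp add: v_def sum_subtractf)
  qed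
  have step: "y + (0, v i, 0) \<in> C" if "y \<in> C" for i y
  proof (cases "i = k")
    case True
    have "v i = 0" using True h by (simp add: v_def)
    then show ?thesis using that by (simp flip: zero_prod_def)
  next
    case False
    let ?a = "(axis i 1 + axis k 1, 0, 0) :: (real ^ 'p) \<times> (real ^ 'p) \<times> real"
    have "h \<bullet> v i = 0"
      using h by (simp add: v_def inner_diff_right inner_axis)
    then have "?a + real n *\<^sub>R (0, v i, 0) \<in> Z_set (Q_c q) h f" for n
      using False q f0
      by (auto simp: Z_set_def Q_c_def v_def axis_def sum.distrib)
    then show ?thesis
      using C by (intro closed_convex_recession[OF C(1,2) that, of ?a]) auto
  qed
  have "(z, \<beta>, t) + (\<Sum>i\<in>UNIV. (0, v i, 0)) \<in> C"
    by (rule translation_sum) (use step y in auto)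
  moreover have "(\<Sum>i\<in>UNIV. (0, v i, 0)) = (0 :: real ^ 'p, b, 0 :: real)"
    using vj by (simp add: prod_eq_iff fst_sum snd_sum vec_eq_iff)
  ultimately show ?thesis by simp
qed

section \<open>The closed convex hull\<close>

definition perspective_relaxation ::
  "real \<Rightarrow> (real ^ 'p::finite) \<Rightarrow> (real \<Rightarrow> real) \<Rightarrow> ((real ^ 'p) \<times> (real ^ 'p) \<times> real) set" where
  "perspective_relaxation q h f =
    {(z, \<beta>, t). (\<forall>i. z $ i \<in> {0..1}) \<and> (\<Sum>i\<in>UNIV. z $ i) \<le> q \<and> f (h \<bullet> \<beta>) \<le> t \<and>
       perspective f (h \<bullet> \<beta>) (\<Sum>i\<in>UNIV. z $ i) \<le> ereal t}"

text \<open>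
  Both nonlinear constraints become families of half-spaces indexed by the same affine minorants,
  from which closedness and convexity can be read off.
\<close>

lemma perspective_relaxation_eq:
  assumes "convex_on UNIV f" "f 0 = 0"
  shows "perspective_relaxation q h f =
    {p. fst p \<in> cbox 0 1} \<inter> {p. (1, 0, 0) \<bullet> p \<le> q} \<inter>
    (\<Inter>(c, d) \<in> {(c, d). affine_minorant f c d}.
       {p. (0, c *\<^sub>R h, -1) \<bullet> p \<le> - d} \<inter> {p. (d *\<^sub>R 1, c *\<^sub>R h, -1) \<bullet> p \<le> 0})"
    (is "_ = ?R")
proof -
  have eq: "(z, \<beta>, t) \<in> perspective_relaxation q h f \<longleftrightarrow> (z, \<beta>, t) \<in> ?R" for z \<beta> t
  proof (cases "z \<in> cbox 0 1")
    case True
    then have "0 \<le> (\<Sum>i\<in>UNIV. z $ i)"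
      by (intro sum_nonneg) (auto simp: mem_box_cart)
    then show ?thesis
      using True
      by (auto simp: perspective_relaxation_def perspective_le_iff_minorants[OF assms]
        convex_on_le_iff_minorants[OF assms(1), of "h \<bullet> \<beta>"] mem_box_cart inner_vec_def[of 1] algebra_simps)
  qed (auto simp: perspective_relaxation_def mem_box_cart)
  show ?thesis
  proof (rule set_eqI)
    show "p \<in> perspective_relaxation q h f \<longleftrightarrow> p \<in> ?R" for p
      by (cases p rule: prod_cases3) (simp only: eq)
  qed
qed

lemma perspective_relaxation_closed_convex:
  assumes "convex_on UNIV f" "f 0 = 0"
  shows "closed (perspective_relaxation q h f)" "convex (perspective_relaxation q h f)"
proof -
  have box: "{p :: (real ^ 'p) \<times> (real ^ 'p) \<times> real. fst p \<in> cbox 0 1} = cbox 0 1 \<times> UNIV"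
    by auto
  show "closed (perspective_relaxation q h f)"
    unfolding perspective_relaxation_eq[OF assms] box
    by (intro closed_Int closed_INT closed_Times closed_halfspace_le closed_cbox closed_UNIV ballI)
      (auto intro!: closed_Int closed_halfspace_le)
  show "convex (perspective_relaxation q h f)"
    unfolding perspective_relaxation_eq[OF assms] box
    by (intro convex_Int convex_INT convex_Times convex_halfspace_le convex_box convex_UNIV)
      (auto intro!: convex_Int convex_halfspace_le)
qed

text \<open>
  A binary \<open>z\<close> is either zero, which forces \<open>\<beta> = 0\<close>, or has sum at least one; in the latter case
  \<open>d \<le> 0\<close> gives \<open>c x + d s \<le> c x + d \<le> f x\<close>.
\<close>

lemma Z_set_subset_perspective_relaxation:
  fixes h :: "real ^ 'p::finite"
  assumes "convex_on UNIV f" "f 0 = 0"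
  shows "Z_set (Q_c q) h f \<subseteq> perspective_relaxation (real q) h f"
proof clarify
  fix z \<beta> t assume "(z, \<beta>, t) \<in> Z_set (Q_c q) h f"
  then have z: "\<And>i. z $ i \<in> {0, 1}" and q: "(\<Sum>i\<in>UNIV. z $ i) \<le> real q"
    and t: "f (h \<bullet> \<beta>) \<le> t" and \<beta>: "\<And>i. \<beta> $ i * (1 - z $ i) = 0"
    by (auto simp: Z_set_def Q_c_def)
  let ?s = "\<Sum>i\<in>UNIV. z $ i"
  have z01: "0 \<le> z $ i" "z $ i \<le> 1" for i using z[of i] by auto
  have s0: "0 \<le> ?s" using z01 by (simp add: sum_nonneg)
  have "c * (h \<bullet> \<beta>) + d * ?s \<le> t" if cd: "affine_minorant f c d" for c d
  proof (cases "\<exists>i. z $ i = 1")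
    case True
    then obtain i where "z $ i = 1" by auto
    then have "1 \<le> ?s" using member_le_sum[of i UNIV "\<lambda>i. z $ i"] z01 by auto
    moreover have "d \<le> 0" using affine_minorantD[OF cd, of 0] assms by simp
    ultimately have "d * ?s \<le> d" by (metis mult_left_mono_neg mult.right_neutral)
    then show ?thesis using affine_minorantD[OF cd, of "h \<bullet> \<beta>"] t by simp
  next
    case False
    then have z0: "z $ i = 0" for i using z[of i] by auto
    then have "\<beta> = 0" using \<beta> by (simp add: vec_eq_iff)
    then show ?thesis using z0 t assms by simp
  qed
  then show "(z, \<beta>, t) \<in> perspective_relaxation (real q) h f"
    using z01 q t s0
    by (auto simp: perspective_relaxation_def perspective_le_iff_minorants[OF assms])
qed

text \<open>
  The facts \<open>large\<close> and \<open>positive\<close> in the proof treat \<open>s \<ge> 1\<close> and \<open>s > 0\<close>; the boundary case \<open>s = 0\<close>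
  then follows by approximation. Translation along the kernel of \<open>h\<close> allows \<open>\<beta>\<close> to be kept fixed
  while \<open>z\<close> varies, so that convex combinations concern \<open>z\<close> alone.
\<close>

lemma perspective_relaxation_subset:
  fixes h :: "real ^ 'p::finite"
  assumes h: "\<And>i. h $ i \<noteq> 0" and f: "convex_on UNIV f" "f 0 = 0" and q: "q \<ge> 2"
    and C: "closed C" "convex C" "Z_set (Q_c q) h f \<subseteq> C"
  shows "perspective_relaxation (real q) h f \<subseteq> C"
proof -
  note move = kernel_translation[where f = f, OF h f(2) q C]
  have zero: "0 \<in> C"
    using C(3) f by (auto simp: Z_set_def Q_c_def zero_prod_def)
  have large: "(z, \<beta>, t) \<in> C" if z: "z \<in> cube_slice 1 (int q)" and t: "f (h \<bullet> \<beta>) \<le> t" for z \<beta> t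
  proof -
    let ?B = "{v :: real ^ 'p. v \<in> cube_slice 1 (int q) \<and> (\<forall>i. v $ i \<in> {0, 1})}"
    have "(v, \<beta>, t) \<in> C" if v: "v \<in> ?B" for v
    proof -
      have "\<exists>i. v $ i = 1"
      proof (rule ccontr)
        assume "\<nexists>i. v $ i = 1"
        then have "v $ i = 0" for i using v by auto
        then show False using v by (simp add: cube_slice_def)
      qed
      then obtain i where i: "v $ i = 1" by auto
      \<comment> \<open>All of \<open>h \<bullet> \<beta>\<close> is loaded on one active coordinate and then redistributed.\<close>
      define b where "b = axis i (h \<bullet> \<beta> / h $ i)"
      have hb: "h \<bullet> b = h \<bullet> \<beta>"
        using h by (simp add: b_def inner_axis)
      then have "(v, b, t) \<in> Z_set (Q_c q) h f"
        using v i t by (auto simp: Z_set_def Q_c_def cube_slice_def b_def axis_def)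
      then have "(v, b + (\<beta> - b), t) \<in> C"
        using C(3) hb by (intro move) (auto simp: inner_diff_right)
      then show ?thesis by simp
    qed
    moreover have "convex {v. (v, \<beta>, t) \<in> C}"
    proof (rule convexI, clarify)
      fix v w u r assume "(v, \<beta>, t) \<in> C" "(w, \<beta>, t) \<in> C" "0 \<le> u" "0 \<le> r" "u + r = (1::real)"
      then show "(u *\<^sub>R v + r *\<^sub>R w, \<beta>, t) \<in> C"
        using convexD[OF C(2), of "(v, \<beta>, t)" "(w, \<beta>, t)" u r]
        by (simp flip: scaleR_add_left distrib_right)
    qed
    ultimately have "convex hull ?B \<subseteq> {v. (v, \<beta>, t) \<in> C}"
      by (intro hull_minimal) auto
    then show ?thesis
      using z cube_slice_eq_hull_binary[of 1 "int q"] by auto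
  qed
  have positive: "(z, \<beta>, t) \<in> C"
    if R: "(z, \<beta>, t) \<in> perspective_relaxation (real q) h f" and s: "0 < (\<Sum>i\<in>UNIV. z $ i)" for z \<beta> t
  proof (cases "1 \<le> (\<Sum>i\<in>UNIV. z $ i)")
    case True
    then show ?thesis
      using R by (intro large) (auto simp: perspective_relaxation_def cube_slice_def)
  next
    case False
    define s where "s = (\<Sum>i\<in>UNIV. z $ i)"
    have s01: "0 < s" "s < 1" using False s by (auto simp: s_def)
    have z: "0 \<le> z $ i" for i using R by (auto simp: perspective_relaxation_def)
    have zs: "z $ i \<le> s" for i
      unfolding s_def using z by (intro member_le_sum) auto
    have "(\<Sum>i\<in>UNIV. (z /\<^sub>R s) $ i) = 1"
      using s01 by (simp add: s_def flip: sum_distrib_left)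
    then have "z /\<^sub>R s \<in> cube_slice 1 (int q)"
      using z zs s01 q by (auto simp: cube_slice_def field_simps)
    moreover have "f (h \<bullet> (\<beta> /\<^sub>R s)) \<le> t / s"
      using R s01 by (auto simp: perspective_relaxation_def perspective_def s_def[symmetric] field_simps)
    ultimately have "(z /\<^sub>R s, \<beta> /\<^sub>R s, t / s) \<in> C" by (rule large)
    then have "s *\<^sub>R (z /\<^sub>R s, \<beta> /\<^sub>R s, t / s) + (1 - s) *\<^sub>R 0 \<in> C"
      using s01 zero by (intro convexD[OF C(2)]) auto
    then show ?thesis using s01 by simp
  qed
  show ?thesis
  proof clarify
    fix z \<beta> t assume R: "(z, \<beta>, t) \<in> perspective_relaxation (real q) h f"
    then have z: "0 \<le> z $ i" for i by (auto simp: perspective_relaxation_def)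
    show "(z, \<beta>, t) \<in> C"
    proof (cases "(\<Sum>i\<in>UNIV. z $ i) = 0")
      case False
      then show ?thesis
        using R z by (intro positive) (simp_all add: order_less_le sum_nonneg)
    next
      case True
      then have z0: "z = 0"
        using z by (simp add: sum_nonneg_eq_0_iff vec_eq_iff)
      obtain k :: 'p where True by simp
      let ?e = "\<lambda>n. 1 / real (Suc n)"
      let ?y = "\<lambda>n. (?e n *\<^sub>R axis k (1 :: real), \<beta>, t)"
      \<comment> \<open>At sum zero the perspective constraint says \<open>c x \<le> t\<close> for all slopes \<open>c\<close> of minorants, where
        \<open>x = h \<bullet> \<beta>\<close>. As their intercepts are nonpositive, the perspective constraint then holds at
        every positive sum with the same \<open>\<beta>\<close> and \<open>t\<close>.\<close>
      have c: "c * (h \<bullet> \<beta>) \<le> t" if "affine_minorant f c d" for c d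
        using R True that
        by (auto simp: perspective_relaxation_def perspective_le_iff_minorants[OF f])
      have y: "?y n \<in> C" for n
      proof (rule positive)
        have s: "(\<Sum>i\<in>UNIV. (?e n *\<^sub>R axis k (1::real)) $ i) = ?e n"
          by (simp add: sum_axis flip: sum_distrib_left sum_divide_distrib)
        show "0 < (\<Sum>i\<in>UNIV. (?e n *\<^sub>R axis k (1::real)) $ i)"
          unfolding s by simp
        have "perspective f (h \<bullet> \<beta>) (?e n) \<le> ereal t"
        proof (subst perspective_le_iff_minorants[OF f], simp, intro allI impI)
          fix c d assume cd: "affine_minorant f c d"
          have "d \<le> 0" using affine_minorantD[OF cd, of 0] f by simp
          then have "d * ?e n \<le> 0" by (intro mult_nonpos_nonneg) auto
          then show "c * (h \<bullet> \<beta>) + d * ?e n \<le> t" using c[OF cd] by simp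
        qed
        moreover have e: "0 \<le> ?e n" "?e n \<le> 1" by simp_all
        moreover have "?e n \<le> real q" using e(2) q by linarith
        ultimately show "?y n \<in> perspective_relaxation (real q) h f"
          
          using R s unfolding perspective_relaxation_def
          by (auto simp: axis_def simp del: of_nat_Suc)
      qed
      have e: "?e \<longlonglongrightarrow> 0"
        using LIMSEQ_inverse_real_of_nat by (simp add: inverse_eq_divide)
      have "?y \<longlonglongrightarrow> (0 *\<^sub>R axis k (1 :: real), \<beta>, t)"
        by (intro tendsto_Pair tendsto_scaleR e tendsto_const)
      then show ?thesis
        using closed_sequentially[OF C(1), of ?y] y z0 by simp
    qed
  qed
qed

theorem proposition4:
  fixes h :: "real ^ 'p::finite" and f :: "real \<Rightarrow> real" and q :: nat
  assumes "\<And>i. h $ i \<noteq> 0"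
    and "convex_on UNIV f"
    and "f 0 = 0"
    and "q \<ge> 2"
  shows "closure (convex hull (Z_set (Q_c q) h f)) =
    {(z, \<beta>, t). (\<forall>i. z $ i \<in> {0..1}) \<and> (\<Sum>i\<in>UNIV. z $ i) \<le> real q \<and> f (h \<bullet> \<beta>) \<le> t \<and>
       perspective f (h \<bullet> \<beta>) (\<Sum>i\<in>UNIV. z $ i) \<le> ereal t}"
  unfolding perspective_relaxation_def[symmetric]
proof
  show "closure (convex hull (Z_set (Q_c q) h f)) \<subseteq> perspective_relaxation (real q) h f"
    using Z_set_subset_perspective_relaxation perspective_relaxation_closed_convex assms
    by (intro closure_minimal hull_minimal) auto
  show "perspective_relaxation (real q) h f \<subseteq> closure (convex hull (Z_set (Q_c q) h f))"
  proof (rule perspective_relaxation_subset[OF assms])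
    show "Z_set (Q_c q) h f \<subseteq> closure (convex hull (Z_set (Q_c q) h f))"
      by (meson closure_subset hull_subset order_trans)
  qed (auto intro: convex_closure convex_convex_hull)
qed

end
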